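(* Let $(\mathfrak g,J,g)$ be a Kähler Lie algebra and assume that $\mathfrak h$ is an abelian ideal satisfying $J\mathfrak h=\mathfrak h=\mathfrak h^\perp$. Thus $\mathfrak g=\mathfrak h\ltimes\mathfrak k$ with $J\mathfrak k\subset\mathfrak k$. Then $\nabla_zy\in\mathfrak h$ for all $y\in\mathfrak h$ and $z\in\mathfrak g$; in particular $\nabla_xy=0$ for all $x,y\in\mathfrak h$. Thus the normal subgroup $H$ corresponding to the ideal $\mathfrak h$ on the Lie group $G$ is totally geodesic.
   Context: All Lie algebras are real and finite dimensional. A complex structure is an endomorphism $J$ with $J^2=-I$ and $[Jx,Jy]-[x,y]-J[Jx,y]-J[x,Jy]=0$. A Kähler Lie algebra is a Lie algebra with a complex structure $J$ and a closed nondegenerate 2-form $\omega$ (closed: $\omega([x,y],z)+\omega([y,z],x)+\omega([z,x],y)=0$) with $\omega(Jx,Jy)=\omega(x,y)$; the associated pseudo-Kähler metric is $g(x,y)=\omega(Jx,y)$, not necessarily definite, and one writes $(\mathfrak g,J,g)$. $\mathfrak h^\perp$ is the orthogonal of $\mathfrak h$ with respect to $g$. The notation $\mathfrak g=\mathfrak h\ltimes\mathfrak k$ means that $\mathfrak g$ is the semidirect product of the ideal $\mathfrak h$ and a subalgebra $\mathfrak k$. $\nabla$ is the Levi-Civita connection of $g$, given on $\mathfrak g$ by $2g(\nabla_xy,z)=g([x,y],z)-g([y,z],x)+g([z,x],y)$. $G$ is the simply connected Lie group with Lie algebra $\mathfrak g$, with the left invariant metric induced by $g$. A subgroup with Lie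 algebra $\mathfrak w$ is totally geodesic if $\nabla_uv\in\mathfrak w$ for all $u,v\in\mathfrak w$.
   Formalization: The decomposition g = h ⋉ k is proved only with k a J-stable linear complement of the ideal h, not a subalgebra: a complementary subalgebra need not exist (R^4, [e1,e2]=e3, Je1=e2, Je3=e4, ω=e1*∧e3*+e2*∧e4*, h=span{e3,e4}). *)

theory Defs
  imports "HOL-Analysis.Analysis"
begin

locale real_lie_algebra =
  fixes bracket :: "'a::real_vector \<Rightarrow> 'a \<Rightarrow> 'a"
  assumes finite_dimensional: "\<exists>B :: 'a set. finite B \<and> span B = UNIV"
    and bilinear_bracket: "bilinear bracket"
    and bracket_self: "bracket x x = 0"
    and jacobi: "bracket x (bracket y z) + bracket y (bracket z x) + bracket z (bracket x y) = 0"

definition complex_structure :: "('a::real_vector \<Rightarrow> 'a \<Rightarrow> 'a) \<Rightarrow> ('a \<Rightarrow> 'a) \<Rightarrow> bool" where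
  "complex_structure bracket J \<longleftrightarrow>
     linear J \<and> (\<forall>x. J (J x) = - x) \<and>
     (\<forall>x y. bracket (J x) (J y) - bracket x y - J (bracket (J x) y) - J (bracket x (J y)) = 0)"

definition nondegenerate :: "('a::real_vector \<Rightarrow> 'a \<Rightarrow> real) \<Rightarrow> bool" where
  "nondegenerate b \<longleftrightarrow> (\<forall>x. (\<forall>y. b x y = 0) \<longrightarrow> x = 0)"

definition closed_form :: "('a::real_vector \<Rightarrow> 'a \<Rightarrow> 'a) \<Rightarrow> ('a \<Rightarrow> 'a \<Rightarrow> real) \<Rightarrow> bool" where
  "closed_form bracket \<omega> \<longleftrightarrow>
     (\<forall>x y z. \<omega> (bracket x y) z + \<omega> (bracket y z) x + \<omega> (bracket z x) y = 0)"

locale kaehler_lie_algebra = real_lie_algebra bracket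
  for bracket :: "'a::real_vector \<Rightarrow> 'a \<Rightarrow> 'a" +
  fixes J :: "'a \<Rightarrow> 'a" and \<omega> :: "'a \<Rightarrow> 'a \<Rightarrow> real"
  assumes complex_structure: "complex_structure bracket J"
    and bilinear_form: "bilinear \<omega>"
    and form_self: "\<omega> x x = 0"
    and nondegenerate_form: "nondegenerate \<omega>"
    and closed_form: "closed_form bracket \<omega>"
    and form_compatible: "\<omega> (J x) (J y) = \<omega> x y"

definition kaehler_metric :: "('a::real_vector \<Rightarrow> 'a) \<Rightarrow> ('a \<Rightarrow> 'a \<Rightarrow> real) \<Rightarrow> 'a \<Rightarrow> 'a \<Rightarrow> real" where
  "kaehler_metric J \<omega> x y = \<omega> (J x) y"

(* The library's orthogonal_comp refers to the inner product of the type class; here the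
   orthogonal is taken with respect to a possibly indefinite form. *)
definition form_orthogonal :: "('a::real_vector \<Rightarrow> 'a \<Rightarrow> real) \<Rightarrow> 'a set \<Rightarrow> 'a set" where
  "form_orthogonal g \<hh> = {x. \<forall>y\<in>\<hh>. g x y = 0}"

(* The description determines a unique vector when g is nondegenerate;
   see levi_civita_koszul below. *)
definition levi_civita ::
    "('a::real_vector \<Rightarrow> 'a \<Rightarrow> 'a) \<Rightarrow> ('a \<Rightarrow> 'a \<Rightarrow> real) \<Rightarrow> 'a \<Rightarrow> 'a \<Rightarrow> 'a" where
  "levi_civita bracket g x y =
     (THE w. \<forall>z. 2 * g w z = g (bracket x y) z - g (bracket y z) x + g (bracket z x) y)"

definition lie_subalgebra :: "('a::real_vector \<Rightarrow> 'a \<Rightarrow> 'a) \<Rightarrow> 'a set \<Rightarrow> bool" where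
  "lie_subalgebra bracket \<ww> \<longleftrightarrow> subspace \<ww> \<and> (\<forall>x\<in>\<ww>. \<forall>y\<in>\<ww>. bracket x y \<in> \<ww>)"

definition lie_ideal :: "('a::real_vector \<Rightarrow> 'a \<Rightarrow> 'a) \<Rightarrow> 'a set \<Rightarrow> bool" where
  "lie_ideal bracket \<hh> \<longleftrightarrow> subspace \<hh> \<and> (\<forall>x. \<forall>y\<in>\<hh>. bracket x y \<in> \<hh>)"

definition abelian_ideal :: "('a::real_vector \<Rightarrow> 'a \<Rightarrow> 'a) \<Rightarrow> 'a set \<Rightarrow> bool" where
  "abelian_ideal bracket \<hh> \<longleftrightarrow> lie_ideal bracket \<hh> \<and> (\<forall>x\<in>\<hh>. \<forall>y\<in>\<hh>. bracket x y = 0)"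

(* Complementary as vector subspaces only: an abelian ideal \<hh> with J \<hh> = \<hh> and \<hh> equal to its
   own orthogonal need not have a complementary subalgebra.  On R^4 take [e1,e2] = e3, J e1 = e2,
   J e3 = e4, \<omega> = e1* /\ e3* + e2* /\ e4*, \<hh> = span {e3,e4}: if x, y span a complement of \<hh>,
   then [x,y] is a nonzero multiple of e3, which lies in \<hh>. *)
definition complementary :: "'a::real_vector set \<Rightarrow> 'a set \<Rightarrow> bool" where
  "complementary \<hh> \<kk> \<longleftrightarrow> subspace \<hh> \<and> subspace \<kk> \<and> \<hh> \<inter> \<kk> = {0} \<and> {x + y |x y. x \<in> \<hh> \<and> y \<in> \<kk>} = UNIV"

(* For a left invariant metric this is the condition, read off at the identity, that the connected
   Lie subgroup with Lie algebra \<ww> be totally geodesic; that subgroup is normal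
   in the connected ambient group iff \<ww> is an ideal. *)
definition totally_geodesic ::
    "('a::real_vector \<Rightarrow> 'a \<Rightarrow> 'a) \<Rightarrow> ('a \<Rightarrow> 'a \<Rightarrow> real) \<Rightarrow> 'a set \<Rightarrow> bool" where
  "totally_geodesic bracket g \<ww> \<longleftrightarrow>
     lie_subalgebra bracket \<ww> \<and> (\<forall>u\<in>\<ww>. \<forall>v\<in>\<ww>. levi_civita bracket g u v \<in> \<ww>)"

lemma kaehler_metric_nondegenerate:
  assumes "kaehler_lie_algebra bracket J \<omega>"
  shows "bilinear (kaehler_metric J \<omega>)" "nondegenerate (kaehler_metric J \<omega>)"
proof -
  interpret kaehler_lie_algebra bracket J \<omega> by fact
  have J: "linear J" and JJ: "\<And>x. J (J x) = - x"
    using complex_structure by (auto simp: complex_structure_def)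
  have "linear (\<lambda>x. \<omega> (J x) y)" for y
    using linear_compose[OF J, of "\<lambda>x. \<omega> x y"] bilinear_form by (simp add: bilinear_def o_def)
  then show "bilinear (kaehler_metric J \<omega>)"
    using bilinear_form by (simp add: bilinear_def kaehler_metric_def)
  have "x = 0" if "\<forall>y. \<omega> (J x) y = 0" for x
  proof -
    have "J x = 0" using that nondegenerate_form by (auto simp: nondegenerate_def)
    then show "x = 0" using JJ[of x] linear_0[OF J] by simp
  qed
  then show "nondegenerate (kaehler_metric J \<omega>)"
    by (auto simp: nondegenerate_def kaehler_metric_def)
qed

lemma nondegenerate_represents:
  fixes g :: "'a::real_vector \<Rightarrow> 'a \<Rightarrow> real"
  assumes fin: "finite (B :: 'a set)" "span B = UNIV"
    and g: "bilinear g" "nondegenerate g" and f: "linear f"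
  shows "\<exists>!w. \<forall>z. g w z = f z"
proof -
  obtain B' where B': "B' \<subseteq> B" "independent B'" "B \<subseteq> span B'"
    using maximal_independent_subset by blast
  have spB': "span B' = UNIV"
    using fin(2) B'(3) span_mono span_span by (metis top.extremum_uniqueI)
  have finB': "finite B'" using B'(1) fin(1) finite_subset by blast
  interpret fd: finite_dimensional_vector_space "scaleR :: real \<Rightarrow> 'a \<Rightarrow> 'a" B'
    using B'(2) spB' finB' by unfold_locales (auto simp: dependent_raw_def span_raw_def)
  have ext: "\<forall>z. h1 z = h2 z" if "linear h1" "linear h2" "\<forall>b\<in>B'. h1 b = h2 b"
    for h1 h2 :: "'a \<Rightarrow> real"
    using linear_eq_on_span[OF that(1,2), of B'] that(3) spB' by auto
  have glin: "linear (g w)" for w using g(1) by (simp add: bilinear_def)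
  define T where "T w = (\<Sum>b\<in>B'. g w b *\<^sub>R b)" for w
  have linT: "linear T"
    by (rule linearI)
      (simp_all add: T_def bilinear_ladd[OF g(1)] bilinear_lmul[OF g(1)] scaleR_add_left
        sum.distrib scaleR_sum_right)
  have eqB: "\<forall>b\<in>B'. c b = d b"
    if "(\<Sum>b\<in>B'. c b *\<^sub>R b) = (\<Sum>b\<in>B'. d b *\<^sub>R b)" for c d :: "'a \<Rightarrow> real"
  proof -
    have "(\<Sum>b\<in>B'. (c b - d b) *\<^sub>R b) = 0"
      using that by (simp add: scaleR_diff_left sum_subtractf)
    then show ?thesis
      using B'(2) finB' independentD[of B' B' "\<lambda>b. c b - d b"] by auto
  qed
  have inj: "w1 = w2" if "\<forall>z. g w1 z = g w2 z" for w1 w2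
  proof -
    have "\<forall>z. g (w1 - w2) z = 0" using that by (simp add: bilinear_lsub[OF g(1)])
    then show ?thesis using g(2) by (auto simp: nondegenerate_def)
  qed
  have "inj T"
  proof (rule injI)
    fix w1 w2 assume "T w1 = T w2"
    then have "\<forall>b\<in>B'. g w1 b = g w2 b" using eqB unfolding T_def by blast
    then show "w1 = w2" using inj ext[OF glin glin] by blast
  qed
  then have "surj T" using fd.linear_inj_imp_surj linT by (simp add: linear_def)
  then obtain w where "T w = (\<Sum>b\<in>B'. f b *\<^sub>R b)" by (metis surjD)
  then have "\<forall>b\<in>B'. g w b = f b" using eqB unfolding T_def by blast
  then have "\<forall>z. g w z = f z" using ext[OF glin f] by blast
  then show ?thesis using inj by metis
qed

lemma levi_civita_koszul:
  assumes "real_lie_algebra bracket" "bilinear g" "nondegenerate g"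
  shows "2 * g (levi_civita bracket g x y) z =
    g (bracket x y) z - g (bracket y z) x + g (bracket z x) y"
proof -
  interpret real_lie_algebra bracket by fact
  obtain B :: "'a set" where B: "finite B" "span B = UNIV" using finite_dimensional by blast
  let ?f = "\<lambda>z. (g (bracket x y) z - g (bracket y z) x + g (bracket z x) y) / 2"
  have "linear ?f"
    by (rule linearI)
      (simp_all add: bilinear_ladd[OF assms(2)] bilinear_radd[OF assms(2)]
        bilinear_lmul[OF assms(2)] bilinear_rmul[OF assms(2)] bilinear_ladd[OF bilinear_bracket]
        bilinear_radd[OF bilinear_bracket] bilinear_lmul[OF bilinear_bracket]
        bilinear_rmul[OF bilinear_bracket] field_simps)
  from nondegenerate_represents[OF B assms(2,3) this]
  have "\<exists>!w. \<forall>z. g w z = ?f z" .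
  then have "\<exists>!w. \<forall>z. 2 * g w z = g (bracket x y) z - g (bracket y z) x + g (bracket z x) y"
    by (simp add: field_simps)
  from theI'[OF this] show ?thesis unfolding levi_civita_def by blast
qed

end

theory Submission
  imports Defs
begin

text \<open>
  In the Koszul formula for \<open>2 * g (\<nabla>\<^sub>z y) x\<close> each term pairs a bracket with one of the
  vectors. If \<open>x\<close> and \<open>y\<close> lie in the abelian ideal \<open>\<hh>\<close>, the bracket of \<open>x\<close> and \<open>y\<close> vanishes,
  and the other two brackets lie in \<open>\<hh>\<close> and are paired with vectors of \<open>\<hh>\<close>, so isotropy kills
  them. Thus \<open>\<nabla>\<^sub>z y\<close> is orthogonal to \<open>\<hh>\<close>, that is, lies in \<open>\<hh>\<close>
  (\<open>levi_civita_orthogonal_to_isotropic_abelian_ideal\<close>). If instead both arguments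
  \<open>x\<close>, \<open>y\<close> of the connection lie in \<open>\<hh>\<close>, the same count shows that \<open>\<nabla>\<^sub>x y\<close> is orthogonal to
  everything, hence zero (\<open>levi_civita_zero_on_isotropic_abelian_ideal\<close>).
  The \<open>J\<close>-invariant complement is the kernel of a projection onto \<open>\<hh>\<close>
  averaged so as to commute with \<open>J\<close> (\<open>invariant_complement_of_complex_subspace\<close>).
\<close>

text \<open>
  Averaging a real projection \<open>P\<close> onto \<open>V\<close> over the group generated by \<open>J\<close> gives
  \<open>Q = (P - J P J) / 2\<close>. It is still a projection onto \<open>V\<close> because \<open>J\<close> preserves \<open>V\<close>, and it
  commutes with \<open>J\<close>, so its kernel is an invariant complement.
\<close>

lemma invariant_complement_of_complex_subspace:
  fixes J :: "'a::real_vector \<Rightarrow> 'a"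
  assumes J: "linear J" and JJ: "\<And>x. J (J x) = - x"
    and V: "subspace V" and JV: "J ` V \<subseteq> V"
  shows "\<exists>W. complementary V W \<and> J ` W \<subseteq> W"
proof -
  obtain P where P: "range P \<subseteq> V" "linear P" "\<And>v. v \<in> V \<Longrightarrow> P v = v"
    using linear_exists_left_inverse_on[OF linear_id V] by auto
  define Q where "Q x = (1/2) *\<^sub>R (P x - J (P (J x)))" for x
  note lin_simps = linear_add[OF J] linear_add[OF P(2)] linear_scale[OF J] linear_scale[OF P(2)]
    linear_diff[OF J] linear_neg[OF J] linear_neg[OF P(2)]
  have Q_lin: "linear Q"
    by (rule linearI) (simp_all add: Q_def lin_simps algebra_simps)
  have Q_in: "Q x \<in> V" for x
    unfolding Q_def using P(1) JV by (intro subspace_scale[OF V] subspace_diff[OF V]) auto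
  have Q_id: "Q v = v" if "v \<in> V" for v
  proof -
    have "P (J v) = J v" using that JV by (intro P(3)) auto
    then show ?thesis
      using that by (simp add: Q_def P(3) JJ flip: scaleR_2)
  qed
  have Q_J: "Q (J x) = J (Q x)" for x
    by (simp add: Q_def JJ lin_simps algebra_simps)
  let ?W = "{x. Q x = 0}"
  have W: "subspace ?W" by (rule linear_subspace_kernel[OF Q_lin])
  have int: "V \<inter> ?W = {0}"
    using Q_id subspace_0[OF V] subspace_0[OF W] by auto
  have "z \<in> {x + y |x y. x \<in> V \<and> y \<in> ?W}" for z
  proof -
    have "Q (z - Q z) = 0" by (simp add: linear_diff[OF Q_lin] Q_id[OF Q_in])
    moreover have "z = Q z + (z - Q z)" by simp
    ultimately show ?thesis using Q_in[of z] by blast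
  qed
  then have "complementary V ?W"
    unfolding complementary_def using V W int by blast
  moreover have "J ` ?W \<subseteq> ?W" by (auto simp: Q_J linear_0[OF J])
  ultimately show ?thesis by blast
qed

text \<open>
  Ideals are defined by absorbing brackets from the left; the Koszul formula has elements of the
  ideal in either slot, which antisymmetry makes equivalent.
\<close>

lemma lie_ideal_bracket:
  assumes "real_lie_algebra bracket" "lie_ideal bracket \<hh>" "y \<in> \<hh>"
  shows "bracket x y \<in> \<hh>" "bracket y x \<in> \<hh>"
proof -
  interpret real_lie_algebra bracket by fact
  show xy: "bracket x y \<in> \<hh>" using assms by (auto simp: lie_ideal_def)
  \<comment> \<open>Antisymmetry comes from polarizing the alternating law on \<open>x + y\<close>.\<close>
  have "bracket (x + y) (x + y) = 0" by (rule bracket_self)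
  then have "bracket y x + bracket x y = 0"
    unfolding bilinear_ladd[OF bilinear_bracket] bilinear_radd[OF bilinear_bracket]
    by (simp add: bracket_self add.commute)
  then have "bracket y x = - bracket x y" by (simp add: eq_neg_iff_add_eq_0)
  then show "bracket y x \<in> \<hh>" using xy assms(2) by (auto simp: lie_ideal_def subspace_neg)
qed

text \<open>
  In both lemmas below the bracket inside \<open>\<hh>\<close> is zero and each of the other two Koszul terms is
  \<open>g\<close> of two vectors of \<open>\<hh>\<close>. They differ in which slot is unrestricted: the direction of
  differentiation here, the test vector in the second lemma, which is why only the latter reaches
  zero by nondegeneracy.
\<close>

lemma levi_civita_orthogonal_to_isotropic_abelian_ideal:
  assumes lie: "real_lie_algebra bracket" and g: "bilinear g" "nondegenerate g"
    and ideal: "abelian_ideal bracket \<hh>" and isotropic: "\<hh> \<subseteq> form_orthogonal g \<hh>"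
    and y: "y \<in> \<hh>"
  shows "levi_civita bracket g z y \<in> form_orthogonal g \<hh>"
proof -
  have "g (levi_civita bracket g z y) x = 0" if x: "x \<in> \<hh>" for x
  proof -
    have I: "lie_ideal bracket \<hh>" and yx: "bracket y x = 0"
      using ideal x y by (auto simp: abelian_ideal_def)
    have "g (bracket z y) x = 0" "g (bracket x z) y = 0"
      using isotropic x y lie_ideal_bracket[OF lie I] unfolding form_orthogonal_def by blast+
    then show ?thesis
      using levi_civita_koszul[OF lie g, of z y x] by (simp add: yx bilinear_lzero[OF g(1)])
  qed
  then show ?thesis by (simp add: form_orthogonal_def)
qed

lemma levi_civita_zero_on_isotropic_abelian_ideal:
  assumes lie: "real_lie_algebra bracket" and g: "bilinear g" "nondegenerate g"
    and ideal: "abelian_ideal bracket \<hh>" and isotropic: "\<hh> \<subseteq> form_orthogonal g \<hh>"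
    and x: "x \<in> \<hh>" and y: "y \<in> \<hh>"
  shows "levi_civita bracket g x y = 0"
proof -
  have I: "lie_ideal bracket \<hh>" and xy: "bracket x y = 0"
    using ideal x y by (auto simp: abelian_ideal_def)
  have "g (levi_civita bracket g x y) z = 0" for z
  proof -
    have "g (bracket y z) x = 0" "g (bracket z x) y = 0"
      using isotropic x y lie_ideal_bracket[OF lie I] unfolding form_orthogonal_def by blast+
    then show ?thesis
      using levi_civita_koszul[OF lie g, of x y z] by (simp add: xy bilinear_lzero[OF g(1)])
  qed
  then show ?thesis using g(2) by (simp add: nondegenerate_def)
qed

theorem proposition4p2:
  fixes bracket :: "'a::real_vector \<Rightarrow> 'a \<Rightarrow> 'a"
    and J :: "'a \<Rightarrow> 'a"
    and \<omega> g :: "'a \<Rightarrow> 'a \<Rightarrow> real"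
    and \<hh> :: "'a set"
  assumes kaehler: "kaehler_lie_algebra bracket J \<omega>"
    and metric: "g = kaehler_metric J \<omega>"
    and ideal: "abelian_ideal bracket \<hh>"
    and J_invariant: "J ` \<hh> = \<hh>"
    and lagrangian: "\<hh> = form_orthogonal g \<hh>"
  shows "(\<exists>\<kk>. complementary \<hh> \<kk> \<and> J ` \<kk> \<subseteq> \<kk>) \<and>
    (\<forall>z. \<forall>y\<in>\<hh>. levi_civita bracket g z y \<in> \<hh>) \<and>
    (\<forall>x\<in>\<hh>. \<forall>y\<in>\<hh>. levi_civita bracket g x y = 0) \<and>
    totally_geodesic bracket g \<hh>"
proof -
  interpret kaehler_lie_algebra bracket J \<omega> by (rule kaehler)
  have lie: "real_lie_algebra bracket" by unfold_locales
  have g: "bilinear g" "nondegenerate g"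
    using kaehler_metric_nondegenerate[OF kaehler] by (simp_all add: metric)
  have I: "lie_ideal bracket \<hh>" using ideal by (simp add: abelian_ideal_def)
  then have sub: "subspace \<hh>" by (simp add: lie_ideal_def)
  have "\<exists>\<kk>. complementary \<hh> \<kk> \<and> J ` \<kk> \<subseteq> \<kk>"
    using complex_structure J_invariant sub
    by (intro invariant_complement_of_complex_subspace) (auto simp: complex_structure_def)
  moreover have isotropic: "\<hh> \<subseteq> form_orthogonal g \<hh>" using lagrangian by blast
  moreover have nabla: "levi_civita bracket g z y \<in> \<hh>" if "y \<in> \<hh>" for y z
    using levi_civita_orthogonal_to_isotropic_abelian_ideal[OF lie g ideal isotropic that]
      lagrangian by blast
  moreover have "levi_civita bracket g x y = 0" if "x \<in> \<hh>" "y \<in> \<hh>" for x y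
    by (rule levi_civita_zero_on_isotropic_abelian_ideal[OF lie g ideal isotropic that])
  moreover have "totally_geodesic bracket g \<hh>"
    using I sub nabla by (auto simp: totally_geodesic_def lie_subalgebra_def lie_ideal_def)
  ultimately show ?thesis by blast
qed

end
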